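(* Let $(X,L)$ be a convergence space and $\nu\in\{1,\mathrm{fin}\}$. (i) The games $\mathsf G_\nu(\mathcal C_L,\mathcal C_L)$ and $\mathsf G_\nu(\mathcal O(Y_L),\mathcal O(Y_L))$ are strategically equivalent. (ii) The games $\mathsf G_\nu(\mathcal C_L,\operatorname{Cov}(X))$ and $\mathsf G_\nu(\mathcal O(Y_L),\mathcal D(Y_L))$ are strategically equivalent. Moreover, the corresponding selection principles are equivalent: $\mathsf S_\nu(\mathcal C_L,\mathcal C_L)$ holds iff $\mathsf S_\nu(\mathcal O(Y_L),\mathcal O(Y_L))$ holds, and $\mathsf S_\nu(\mathcal C_L,\operatorname{Cov}(X))$ holds iff $\mathsf S_\nu(\mathcal O(Y_L),\mathcal D(Y_L))$ holds.
   Context: All filters are proper. $\operatorname{Fil}(X)$ is the set of filters on $X$, and $\dot x=\{A\subseteq X:x\in A\}$. A convergence on $X$ is a function $L:\operatorname{Fil}(X)\to\mathcal P(X)$ such that $x\in L(\dot x)$ for every $x\in X$, and $L(\mathcal F)\subseteq L(\mathcal G)$ whenever $\mathcal F\subseteq\mathcal G$; then $(X,L)$ is a convergence space. Put $\Sigma_L=\{\mathcal F\in\operatorname{Fil}(X):L(\mathcal F)\neq\varnothing\}$. A family $\mathcal U\subseteq\mathcal P(X)$ is an $L$-cover if $\mathcal U\cap\mathcal F\neq\varnothing$ for every $\mathcal F\in\Sigma_L$; $\mathcal C_L$ is the family of all $L$-covers. $\operatorname{Cov}(X)$ is the family of all covers of $X$ by subsets of $X$. For $A\subseteq X$ put $A^\bullet=\{\mathcal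 F\in\Sigma_L:A\in\mathcal F\}$. The sets $A^\bullet$ form a base for a topology on $\Sigma_L$; $Y_L$ denotes $\Sigma_L$ with this topology. For a topological space $Y$, $\mathcal O(Y)$ is the family of all open covers of $Y$, and $\mathcal D(Y)$ is the collection of all families of open subsets of $Y$ whose union is dense in $Y$. For collections $\mathcal A,\mathcal B$ of families of sets: $\mathsf S_1(\mathcal A,\mathcal B)$ asserts that for every sequence $\langle\mathcal U_n:n<\omega\rangle$ in $\mathcal A$ there are $U_n\in\mathcal U_n$ with $\{U_n:n<\omega\}\in\mathcal B$; $\mathsf S_{\mathrm{fin}}(\mathcal A,\mathcal B)$ asserts that there are finite $\mathcal V_n\subseteq\mathcal U_n$ with $\bigcup_{n<\omega}\mathcal V_n\in\mathcal B$. In the game $\mathsf G_1(\mathcal A,\mathcal B)$ (resp. $\mathsf G_{\mathrm{fin}}(\mathcal A,\mathcal B)$), in each inning $n<\omega$ Alice chooses $\mathcal U_n\in\mathcal A$ and then Bob chooses a member (resp. a finite subfamily) of $\mathcal U_n$; Bob wins if the family of all sets he selected belongs to $\mathcal B$, otherwise Alice wins. Two games are strategically equivalent if Alice has a winning strategy in one iff she has one in the other, and likewise for Bob. *)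

theory Defs
  imports "HOL-Analysis.Abstract_Topology"
begin

section \<open>Filters on a set and convergence spaces\<close>

text \<open>
  The type of filters contains the improper filter \<open>bot\<close> and is ordered by reverse inclusion
  of the families of sets. A proper filter on a subset \<open>X\<close> of the type is represented by the
  proper filter on the whole type that it generates, that is, by a filter \<open>F \<noteq> bot\<close> containing
  \<open>X\<close>; its members are then recovered by \<open>filter_sets X F\<close>.
\<close>

definition Fil :: "'a set \<Rightarrow> 'a filter set" where
  "Fil X = {F. F \<noteq> bot \<and> F \<le> principal X}"

definition filter_sets :: "'a set \<Rightarrow> 'a filter \<Rightarrow> 'a set set" where
  "filter_sets X F = {A. A \<subseteq> X \<and> eventually (\<lambda>x. x \<in> A) F}"

lemma filter_sets_subset_iff:
  assumes "F \<in> Fil X" "G \<in> Fil X"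
  shows "filter_sets X F \<subseteq> filter_sets X G \<longleftrightarrow> G \<le> F"
proof
  assume sub: "filter_sets X F \<subseteq> filter_sets X G"
  show "G \<le> F"
  proof (rule filter_leI)
    fix P assume P: "eventually P F"
    have "eventually (\<lambda>x. x \<in> X) F"
      using assms(1) by (simp add: Fil_def le_principal)
    with P have "eventually (\<lambda>x. x \<in> {x \<in> X. P x}) F"
      by eventually_elim auto
    then have "{x \<in> X. P x} \<in> filter_sets X F"
      by (auto simp: filter_sets_def)
    with sub have "{x \<in> X. P x} \<in> filter_sets X G"
      by (rule subsetD)
    then have "eventually (\<lambda>x. x \<in> {x \<in> X. P x}) G"
      by (simp add: filter_sets_def)
    then show "eventually P G"
      by eventually_elim auto
  qed
qed (auto simp: filter_sets_def le_filter_def)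

lemma filter_sets_principal:
  "x \<in> X \<Longrightarrow> filter_sets X (principal {x}) = {A. A \<subseteq> X \<and> x \<in> A}"
  by (auto simp: filter_sets_def eventually_principal)

definition convergence_space :: "'a set \<Rightarrow> ('a filter \<Rightarrow> 'a set) \<Rightarrow> bool" where
  "convergence_space X L \<longleftrightarrow>
     (\<forall>F\<in>Fil X. L F \<subseteq> X) \<and>
     (\<forall>x\<in>X. x \<in> L (principal {x})) \<and>
     (\<forall>F\<in>Fil X. \<forall>G\<in>Fil X. filter_sets X F \<subseteq> filter_sets X G \<longrightarrow> L F \<subseteq> L G)"

definition conv_filters :: "'a set \<Rightarrow> ('a filter \<Rightarrow> 'a set) \<Rightarrow> 'a filter set" where
  "conv_filters X L = {F \<in> Fil X. L F \<noteq> {}}"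

definition L_covers :: "'a set \<Rightarrow> ('a filter \<Rightarrow> 'a set) \<Rightarrow> 'a set set set" where
  "L_covers X L =
     {\<U>. \<U> \<subseteq> Pow X \<and> (\<forall>F\<in>conv_filters X L. \<U> \<inter> filter_sets X F \<noteq> {})}"

definition Cov :: "'a set \<Rightarrow> 'a set set set" where
  "Cov X = {\<U>. \<U> \<subseteq> Pow X \<and> \<Union>\<U> = X}"


section \<open>The space of convergent filters\<close>

definition bullet :: "'a set \<Rightarrow> ('a filter \<Rightarrow> 'a set) \<Rightarrow> 'a set \<Rightarrow> 'a filter set" where
  "bullet X L A = {F \<in> conv_filters X L. A \<in> filter_sets X F}"

definition conv_filter_space :: "'a set \<Rightarrow> ('a filter \<Rightarrow> 'a set) \<Rightarrow> 'a filter topology" where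
  "conv_filter_space X L = topology (arbitrary union_of (\<lambda>U. U \<in> bullet X L ` Pow X))"

lemma openin_conv_filter_space:
  "openin (conv_filter_space X L) = arbitrary union_of (\<lambda>U. U \<in> bullet X L ` Pow X)"
proof -
  have *: "bullet X L A \<inter> bullet X L B = bullet X L (A \<inter> B)" if "A \<subseteq> X" "B \<subseteq> X" for A B
    using that by (auto simp: bullet_def filter_sets_def eventually_conj_iff)
  have "S \<inter> T \<in> bullet X L ` Pow X"
    if "S \<in> bullet X L ` Pow X" "T \<in> bullet X L ` Pow X" for S T
  proof -
    from that obtain A B where "A \<subseteq> X" "S = bullet X L A" "B \<subseteq> X" "T = bullet X L B"
      by blast
    with * show ?thesis
      by (intro image_eqI[where x = "A \<inter> B"]) auto
  qed
  then have "istopology (arbitrary union_of (\<lambda>U. U \<in> bullet X L ` Pow X))"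
    by (rule istopology_base)
  then show ?thesis
    by (simp add: conv_filter_space_def topology_inverse')
qed

lemma topspace_conv_filter_space: "topspace (conv_filter_space X L) = conv_filters X L"
proof -
  have "bullet X L X = conv_filters X L"
    by (auto simp: bullet_def conv_filters_def Fil_def filter_sets_def le_principal)
  moreover have "openin (conv_filter_space X L) (bullet X L X)"
    unfolding openin_conv_filter_space by (rule arbitrary_union_of_inc) auto
  moreover have "S \<subseteq> conv_filters X L" if "openin (conv_filter_space X L) S" for S
    using that unfolding openin_conv_filter_space union_of_def by (auto simp: bullet_def)
  ultimately show ?thesis
    by (metis openin_subset openin_topspace subset_antisym)
qed

definition open_covers :: "'a topology \<Rightarrow> 'a set set set" where
  "open_covers Y = {\<U>. (\<forall>U\<in>\<U>. openin Y U) \<and> \<Union>\<U> = topspace Y}"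

definition dense_open_families :: "'a topology \<Rightarrow> 'a set set set" where
  "dense_open_families Y =
     {\<U>. (\<forall>U\<in>\<U>. openin Y U) \<and> Y closure_of (\<Union>\<U>) = topspace Y}"


section \<open>Selection principles and selection games\<close>

definition S1 :: "'a set set set \<Rightarrow> 'a set set set \<Rightarrow> bool" where
  "S1 \<A> \<B> \<longleftrightarrow>
     (\<forall>\<U> :: nat \<Rightarrow> 'a set set. (\<forall>n. \<U> n \<in> \<A>) \<longrightarrow>
        (\<exists>U. (\<forall>n. U n \<in> \<U> n) \<and> range U \<in> \<B>))"

definition Sfin :: "'a set set set \<Rightarrow> 'a set set set \<Rightarrow> bool" where
  "Sfin \<A> \<B> \<longleftrightarrow>
     (\<forall>\<U> :: nat \<Rightarrow> 'a set set. (\<forall>n. \<U> n \<in> \<A>) \<longrightarrow>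
        (\<exists>\<V>. (\<forall>n. finite (\<V> n) \<and> \<V> n \<subseteq> \<U> n) \<and> (\<Union>n. \<V> n) \<in> \<B>))"

text \<open>
  A two-player game of length \<open>\<omega>\<close>: the moves of Alice, the replies open to Bob after a move of
  Alice, and the winning condition of Bob on the sequence of all his moves.
\<close>

datatype ('m, 'r) game =
  Game (alice_moves: "'m set") (bob_replies: "'m \<Rightarrow> 'r set") (bob_wins_run: "(nat \<Rightarrow> 'r) \<Rightarrow> bool")

definition G1 :: "'a set set set \<Rightarrow> 'a set set set \<Rightarrow> ('a set set, 'a set) game" where
  "G1 \<A> \<B> = Game \<A> (\<lambda>\<U>. \<U>) (\<lambda>U. range U \<in> \<B>)"

definition Gfin :: "'a set set set \<Rightarrow> 'a set set set \<Rightarrow> ('a set set, 'a set set) game" where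
  "Gfin \<A> \<B> = Game \<A> (\<lambda>\<U>. {\<V>. finite \<V> \<and> \<V> \<subseteq> \<U>}) (\<lambda>\<V>. (\<Union>n. \<V> n) \<in> \<B>)"

text \<open>
  A strategy of a player maps the finite sequence of the opponent's moves so far to the next
  move. Only complete runs count against Alice, so Bob loses if he has no legal reply.
\<close>

definition alice_winning_strategy :: "('m, 'r) game \<Rightarrow> ('r list \<Rightarrow> 'm) \<Rightarrow> bool" where
  "alice_winning_strategy G \<sigma> \<longleftrightarrow>
     (\<forall>rs. (\<forall>n<length rs. rs ! n \<in> bob_replies G (\<sigma> (take n rs))) \<longrightarrow> \<sigma> rs \<in> alice_moves G) \<and>
     (\<forall>r. (\<forall>n. r n \<in> bob_replies G (\<sigma> (map r [0..<n]))) \<longrightarrow> \<not> bob_wins_run G r)"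

definition bob_winning_strategy :: "('m, 'r) game \<Rightarrow> ('m list \<Rightarrow> 'r) \<Rightarrow> bool" where
  "bob_winning_strategy G \<tau> \<longleftrightarrow>
     (\<forall>ms. ms \<noteq> [] \<and> set ms \<subseteq> alice_moves G \<longrightarrow> \<tau> ms \<in> bob_replies G (last ms)) \<and>
     (\<forall>m. (\<forall>n. m n \<in> alice_moves G) \<longrightarrow> bob_wins_run G (\<lambda>n. \<tau> (map m [0..<Suc n])))"

definition strategically_equivalent :: "('m, 'r) game \<Rightarrow> ('n, 's) game \<Rightarrow> bool" where
  "strategically_equivalent G H \<longleftrightarrow>
     ((\<exists>\<sigma>. alice_winning_strategy G \<sigma>) \<longleftrightarrow> (\<exists>\<sigma>. alice_winning_strategy H \<sigma>)) \<and>
     ((\<exists>\<tau>. bob_winning_strategy G \<tau>) \<longleftrightarrow> (\<exists>\<tau>. bob_winning_strategy H \<tau>))"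

end

theory Submission
  imports Defs
begin

text \<open>
  An \<open>L\<close>-cover \<open>\<U>\<close> corresponds to the open cover \<open>{U\<^sup>\<bullet> : U \<in> \<U>}\<close> of \<open>Y\<^sub>L\<close>, and an open cover
  \<open>\<W>\<close> to the \<open>L\<close>-cover of all \<open>A\<close> such that \<open>A\<^sup>\<bullet>\<close> lies inside a member of \<open>\<W>\<close>. Moves of Alice
  are translated in one direction and replies of Bob in the other. As \<open>A\<^sup>\<bullet> \<inter> U\<^sup>\<bullet> = (A \<inter> U)\<^sup>\<bullet>\<close>
  is nonempty iff \<open>A \<inter> U\<close> is, the sets \<open>U\<^sup>\<bullet>\<close> have dense union iff the sets \<open>U\<close> cover \<open>X\<close>.
\<close>

section \<open>Reductions between games\<close>

text \<open>The translation is memoryless: \<open>f\<close> carries a move of Alice from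
  \<open>H\<close> to \<open>G\<close>, and \<open>g\<close> carries Bob's reply back, looking only
  at the current move. One such pair serves the strategies of both players and the selection
  principles; Bob's wins pass from \<open>G\<close> to \<open>H\<close>, Alice's from
  \<open>H\<close> to \<open>G\<close>.\<close>

definition game_reduction ::
    "('m, 'r) game \<Rightarrow> ('n, 's) game \<Rightarrow> ('n \<Rightarrow> 'm) \<Rightarrow> ('n \<Rightarrow> 'r \<Rightarrow> 's) \<Rightarrow> bool" where
  "game_reduction G H f g \<longleftrightarrow>
     (\<forall>m\<in>alice_moves H. f m \<in> alice_moves G \<and>
        (\<forall>r\<in>bob_replies G (f m). g m r \<in> bob_replies H m)) \<and>
     (\<forall>m r. (\<forall>n. m n \<in> alice_moves H \<and> r n \<in> bob_replies G (f (m n))) \<and> bob_wins_run G r \<longrightarrow>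
        bob_wins_run H (\<lambda>n. g (m n) (r n)))"

lemma game_reductionD:
  assumes "game_reduction G H f g"
  shows "m \<in> alice_moves H \<Longrightarrow> f m \<in> alice_moves G"
    and "m \<in> alice_moves H \<Longrightarrow> r \<in> bob_replies G (f m) \<Longrightarrow> g m r \<in> bob_replies H m"
    and "(\<And>n. k n \<in> alice_moves H) \<Longrightarrow> (\<And>n. s n \<in> bob_replies G (f (k n))) \<Longrightarrow>
      bob_wins_run G s \<Longrightarrow> bob_wins_run H (\<lambda>n. g (k n) (s n))"
  using assms by (simp_all add: game_reduction_def)

text \<open>Bob plays \<open>H\<close> by simulating a run of \<open>G\<close>: he feeds the
  translated moves to \<open>\<tau>\<close> and translates its answer back relative to Alice's
  latest move.\<close>

lemma game_reduction_bob:
  fixes G :: "('m, 'r) game" and H :: "('n, 's) game"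
  assumes red: "game_reduction G H f g" and win: "bob_winning_strategy G \<tau>"
  shows "bob_winning_strategy H (\<lambda>ms. g (last ms) (\<tau> (map f ms)))"
proof -
  have reply: "\<tau> (map f ms) \<in> bob_replies G (f (last ms))"
    if "ms \<noteq> []" "set ms \<subseteq> alice_moves H" for ms
  proof -
    have "set (map f ms) \<subseteq> alice_moves G"
      using red that by (auto simp: game_reduction_def)
    then have "\<tau> (map f ms) \<in> bob_replies G (last (map f ms))"
      using win that(1) unfolding bob_winning_strategy_def by blast
    then show ?thesis
      using that(1) by (simp add: last_map)
  qed
  show ?thesis
    unfolding bob_winning_strategy_def
  proof (intro conjI allI impI)
    fix ms assume ms: "ms \<noteq> [] \<and> set ms \<subseteq> alice_moves H"
    then have "last ms \<in> alice_moves H"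
      by (meson last_in_set subsetD)
    then show "g (last ms) (\<tau> (map f ms)) \<in> bob_replies H (last ms)"
      using reply[of ms] ms by (intro game_reductionD(2)[OF red]) auto
  next
    fix m :: "nat \<Rightarrow> 'n" assume m: "\<forall>n. m n \<in> alice_moves H"
    \<comment> \<open>Bob answers in inning \<open>n\<close> after seeing moves 0 to
      \<open>n\<close>, hence \<open>Suc n\<close>; a strategy of Alice sees only the replies below
      \<open>n\<close>.\<close>
    let ?r = "\<lambda>n. \<tau> (map (\<lambda>i. f (m i)) [0..<Suc n])"
    have "\<forall>n. f (m n) \<in> alice_moves G"
      using red m by (simp add: game_reduction_def)
    then have "bob_wins_run G ?r"
      using win unfolding bob_winning_strategy_def by simp
    moreover have "?r n \<in> bob_replies G (f (m n))" for n
      using reply[of "map m [0..<Suc n]"] m by (auto simp: o_def)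
    ultimately have "bob_wins_run H (\<lambda>n. g (m n) (?r n))"
      using m by (intro game_reductionD(3)[OF red]) auto
    then show "bob_wins_run H
        (\<lambda>n. g (last (map m [0..<Suc n])) (\<tau> (map f (map m [0..<Suc n]))))"
      by (simp add: o_def)
  qed
qed

text \<open>\<open>g\<close> needs the \<open>H\<close>-move of the inning it translates, and that
  move is \<open>\<sigma>\<close> applied to the replies translated earlier. So the history is
  rebuilt recursively from the left.\<close>

definition translate_replies :: "('n \<Rightarrow> 'r \<Rightarrow> 's) \<Rightarrow> ('s list \<Rightarrow> 'n) \<Rightarrow> 'r list \<Rightarrow> 's list" where
  "translate_replies g \<sigma> rs = foldl (\<lambda>hs r. hs @ [g (\<sigma> hs) r]) [] rs"

lemma translate_replies_Nil [simp]: "translate_replies g \<sigma> [] = []"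
  and translate_replies_snoc [simp]:
    "translate_replies g \<sigma> (rs @ [r]) =
       translate_replies g \<sigma> rs @ [g (\<sigma> (translate_replies g \<sigma> rs)) r]"
  by (simp_all add: translate_replies_def)

lemma length_translate_replies [simp]: "length (translate_replies g \<sigma> rs) = length rs"
  by (induction rs rule: rev_induct) auto

text \<open>Alice plays \<open>G\<close> by simulating \<open>H\<close>: Bob's replies are
  translated into \<open>H\<close>, \<open>\<sigma>\<close> answers there, and \<open>f\<close>
  turns the answer into a move of \<open>G\<close>. A win of Bob in \<open>G\<close> would give him
  a win in \<open>H\<close> against \<open>\<sigma>\<close>.\<close>

lemma game_reduction_alice:
  assumes red: "game_reduction G H f g" and win: "alice_winning_strategy H \<sigma>"
  shows "alice_winning_strategy G (\<lambda>rs. f (\<sigma> (translate_replies g \<sigma> rs)))"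
proof -
  let ?h = "translate_replies g \<sigma>"
  let ?\<sigma> = "\<lambda>rs. f (\<sigma> (?h rs))"
  have move: "\<sigma> hs \<in> alice_moves H"
    if "\<forall>n<length hs. hs ! n \<in> bob_replies H (\<sigma> (take n hs))" for hs
    using win that unfolding alice_winning_strategy_def by blast
  have lost: "\<not> bob_wins_run H s" if "\<forall>n. s n \<in> bob_replies H (\<sigma> (map s [0..<n]))" for s
    using win that unfolding alice_winning_strategy_def by blast
  \<comment> \<open>\<open>\<sigma>\<close> is only known to move legally after legal replies, while
    \<open>g\<close> is only known to reply legally to legal moves. The induction on the history
    unwinds this mutual dependence.\<close>
  have legal: "\<forall>n<length rs. ?h rs ! n \<in> bob_replies H (\<sigma> (take n (?h rs)))"
    if "\<forall>n<length rs. rs ! n \<in> bob_replies G (?\<sigma> (take n rs))" for rs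
    using that
  proof (induction rs rule: rev_induct)
    case (snoc r rs)
    have "\<forall>n<length rs. rs ! n \<in> bob_replies G (?\<sigma> (take n rs))"
    proof (intro allI impI)
      fix n assume "n < length rs"
      then show "rs ! n \<in> bob_replies G (?\<sigma> (take n rs))"
        using snoc.prems[rule_format, of n] by (simp add: nth_append)
    qed
    then have IH: "\<forall>n<length rs. ?h rs ! n \<in> bob_replies H (\<sigma> (take n (?h rs)))"
      by (rule snoc.IH)
    then have "\<sigma> (?h rs) \<in> alice_moves H"
      by (intro move) simp
    moreover have "r \<in> bob_replies G (?\<sigma> rs)"
      using snoc.prems[rule_format, of "length rs"] by simp
    ultimately have "g (\<sigma> (?h rs)) r \<in> bob_replies H (\<sigma> (?h rs))"
      by (rule game_reductionD(2)[OF red])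
    with IH show ?case
      by (auto simp: nth_append less_Suc_eq)
  qed simp
  show ?thesis
    unfolding alice_winning_strategy_def
  proof (intro conjI allI impI)
    fix rs assume "\<forall>n<length rs. rs ! n \<in> bob_replies G (?\<sigma> (take n rs))"
    then have "\<sigma> (?h rs) \<in> alice_moves H"
      using legal[of rs] by (intro move) simp
    then show "?\<sigma> rs \<in> alice_moves G"
      using red by (simp add: game_reduction_def)
  next
    fix r assume r: "\<forall>n. r n \<in> bob_replies G (?\<sigma> (map r [0..<n]))"
    let ?m = "\<lambda>n. \<sigma> (?h (map r [0..<n]))"
    let ?s = "\<lambda>n. g (?m n) (r n)"
    \<comment> \<open>The translated finite histories are exactly the prefixes of the infinite
      sequence \<open>?s\<close>, so \<open>?s\<close> is a run of Bob's replies against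
      \<open>\<sigma>\<close> itself.\<close>
    have s: "map ?s [0..<n] = ?h (map r [0..<n])" for n
      by (induction n) simp_all
    have m: "?m n \<in> alice_moves H" for n
    proof -
      have "\<forall>k<n. ?h (map r [0..<n]) ! k \<in> bob_replies H (\<sigma> (take k (?h (map r [0..<n]))))"
        using legal[of "map r [0..<n]"] r by (simp add: take_map)
      then show ?thesis
        by (intro move) simp
    qed
    have "\<forall>n. ?s n \<in> bob_replies H (\<sigma> (map ?s [0..<n]))"
      unfolding s using m r by (blast intro: game_reductionD(2)[OF red])
    then have "\<not> bob_wins_run H ?s"
      by (rule lost)
    moreover have "bob_wins_run H ?s" if "bob_wins_run G r"
      using m r[rule_format] that by (rule game_reductionD(3)[OF red])
    ultimately show "\<not> bob_wins_run G r"
      by blast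
  qed
qed

text \<open>A reduction carries Bob's strategies forward and Alice's backward, so two opposite
  reductions give both equivalences. The translations need not be mutually inverse.\<close>

lemma strategically_equivalentI:
  assumes "game_reduction G H f g" "game_reduction H G f' g'"
  shows "strategically_equivalent G H"
  unfolding strategically_equivalent_def
  using assms by (meson game_reduction_alice game_reduction_bob)

text \<open>This is the selection principle in game form: Bob knows Alice's whole sequence in
  advance, so each reply may depend on her later moves too.\<close>

definition bob_can_respond :: "('m, 'r) game \<Rightarrow> bool" where
  "bob_can_respond G \<longleftrightarrow>
     (\<forall>m. (\<forall>n. m n \<in> alice_moves G) \<longrightarrow>
        (\<exists>r. (\<forall>n. r n \<in> bob_replies G (m n)) \<and> bob_wins_run G r))"

lemma S1_iff_bob_can_respond: "S1 \<A> \<B> \<longleftrightarrow> bob_can_respond (G1 \<A> \<B>)"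
  by (simp add: S1_def bob_can_respond_def G1_def)

lemma Sfin_iff_bob_can_respond: "Sfin \<A> \<B> \<longleftrightarrow> bob_can_respond (Gfin \<A> \<B>)"
  by (simp add: Sfin_def bob_can_respond_def Gfin_def)

text \<open>The entire fixed sequence is translated by \<open>f\<close>, answered in
  \<open>G\<close>, and the answers are translated back by \<open>g\<close>.\<close>

lemma game_reduction_bob_can_respond:
  fixes G :: "('m, 'r) game" and H :: "('n, 's) game"
  assumes red: "game_reduction G H f g" and G: "bob_can_respond G"
  shows "bob_can_respond H"
  unfolding bob_can_respond_def
proof (intro allI impI)
  fix m :: "nat \<Rightarrow> 'n" assume m: "\<forall>n. m n \<in> alice_moves H"
  then have "\<forall>n. f (m n) \<in> alice_moves G"
    using red by (simp add: game_reduction_def)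
  with G have "\<exists>r. (\<forall>n. r n \<in> bob_replies G (f (m n))) \<and> bob_wins_run G r"
    by (simp add: bob_can_respond_def)
  then obtain r where r: "\<forall>n. r n \<in> bob_replies G (f (m n))" "bob_wins_run G r"
    by blast
  have "\<forall>n. g (m n) (r n) \<in> bob_replies H (m n)"
    using m r(1) by (blast intro: game_reductionD(2)[OF red])
  moreover have "bob_wins_run H (\<lambda>n. g (m n) (r n))"
    using m r by (intro game_reductionD(3)[OF red]) auto
  ultimately show "\<exists>s. (\<forall>n. s n \<in> bob_replies H (m n)) \<and> bob_wins_run H s"
    by (intro exI conjI)
qed


section \<open>Reductions between selection games\<close>

text \<open>A criterion on families alone, with no innings. The second clause sees only the total
  families of selected sets, so it fits both single and finite selections; \<open>rel_set\<close>
  excludes members of \<open>\<W>\<close> that correspond to nothing in \<open>\<V>\<close>.\<close>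

definition selection_reduction ::
    "('a set \<Rightarrow> 'b set \<Rightarrow> bool) \<Rightarrow> 'a set set set \<Rightarrow> 'a set set set \<Rightarrow>
     'b set set set \<Rightarrow> 'b set set set \<Rightarrow> bool" where
  "selection_reduction R \<A> \<B> \<A>' \<B>' \<longleftrightarrow>
     (\<forall>\<W>\<in>\<A>'. \<exists>\<U>\<in>\<A>. \<forall>U\<in>\<U>. \<exists>W\<in>\<W>. R U W) \<and>
     (\<forall>\<V>\<in>\<B>. \<forall>\<W>. rel_set R \<V> \<W> \<longrightarrow> \<W> \<in> \<B>')"

lemma selection_reduction_game_reductions:
  assumes "selection_reduction R \<A> \<B> \<A>' \<B>'"
  obtains f g where "game_reduction (G1 \<A> \<B>) (G1 \<A>' \<B>') f g"
    "game_reduction (Gfin \<A> \<B>) (Gfin \<A>' \<B>') f (\<lambda>\<W>. (`) (g \<W>))"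
proof -
  have "\<forall>\<W>\<in>\<A>'. \<exists>\<U>. \<U> \<in> \<A> \<and> (\<forall>U\<in>\<U>. \<exists>W\<in>\<W>. R U W)"
    and win: "\<And>\<V> \<W>. \<V> \<in> \<B> \<Longrightarrow> rel_set R \<V> \<W> \<Longrightarrow> \<W> \<in> \<B>'"
    using assms unfolding selection_reduction_def by blast+
  then obtain f where f: "\<And>\<W>. \<W> \<in> \<A>' \<Longrightarrow> f \<W> \<in> \<A>"
    and fR: "\<And>\<W> U. \<W> \<in> \<A>' \<Longrightarrow> U \<in> f \<W> \<Longrightarrow> \<exists>W\<in>\<W>. R U W"
    by metis
  \<comment> \<open>The choice is relative to \<open>\<W>\<close>, because Bob must reply inside the
    cover actually played. Outside \<open>\<W> \<in> \<A>'\<close> and \<open>U \<in> f \<W>\<close>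
    the value is arbitrary.\<close>
  define g where "g \<W> U = (SOME W. W \<in> \<W> \<and> R U W)" for \<W> U
  have g: "g \<W> U \<in> \<W> \<and> R U (g \<W> U)" if "\<W> \<in> \<A>'" "U \<in> f \<W>" for \<W> U
    unfolding g_def by (rule someI_ex) (use fR[OF that] in blast)
  show ?thesis
  proof
    show "game_reduction (G1 \<A> \<B>) (G1 \<A>' \<B>') f g"
      unfolding game_reduction_def G1_def game.sel
    proof (intro conjI ballI allI impI)
      fix m r assume *: "(\<forall>n. m n \<in> \<A>' \<and> r n \<in> f (m n)) \<and> range r \<in> \<B>"
      have "rel_set R (range r) (range (\<lambda>n. g (m n) (r n)))"
        using g * by (auto simp: rel_set_def)
      with * show "range (\<lambda>n. g (m n) (r n)) \<in> \<B>'"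
        by (blast intro: win)
    qed (use f g in auto)
    show "game_reduction (Gfin \<A> \<B>) (Gfin \<A>' \<B>') f (\<lambda>\<W>. (`) (g \<W>))"
      unfolding game_reduction_def Gfin_def game.sel
    proof (intro conjI ballI allI impI)
      fix m r
      assume *: "(\<forall>n. m n \<in> \<A>' \<and> r n \<in> {\<V>. finite \<V> \<and> \<V> \<subseteq> f (m n)}) \<and> (\<Union>n. r n) \<in> \<B>"
      have "R U (g (m n) U)" if "U \<in> r n" for n U
        using g * that by blast
      then have "rel_set R (\<Union>n. r n) (\<Union>n. g (m n) ` r n)"
        by (fastforce simp: rel_set_def)
      with * show "(\<Union>n. g (m n) ` r n) \<in> \<B>'"
        by (blast intro: win)
    qed (use f g in auto)
  qed
qed

lemma selection_reductions_equivalent: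
  assumes "selection_reduction R \<A> \<B> \<A>' \<B>'" "selection_reduction R' \<A>' \<B>' \<A> \<B>"
  shows "strategically_equivalent (G1 \<A> \<B>) (G1 \<A>' \<B>')"
    and "strategically_equivalent (Gfin \<A> \<B>) (Gfin \<A>' \<B>')"
    and "S1 \<A> \<B> \<longleftrightarrow> S1 \<A>' \<B>'"
    and "Sfin \<A> \<B> \<longleftrightarrow> Sfin \<A>' \<B>'"
proof -
  obtain f g where 1: "game_reduction (G1 \<A> \<B>) (G1 \<A>' \<B>') f g"
    "game_reduction (Gfin \<A> \<B>) (Gfin \<A>' \<B>') f (\<lambda>\<W>. (`) (g \<W>))"
    using assms(1) by (rule selection_reduction_game_reductions)
  obtain f' g' where 2: "game_reduction (G1 \<A>' \<B>') (G1 \<A> \<B>) f' g'"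
    "game_reduction (Gfin \<A>' \<B>') (Gfin \<A> \<B>) f' (\<lambda>\<W>. (`) (g' \<W>))"
    using assms(2) by (rule selection_reduction_game_reductions)
  show "strategically_equivalent (G1 \<A> \<B>) (G1 \<A>' \<B>')"
    using 1(1) 2(1) by (rule strategically_equivalentI)
  show "strategically_equivalent (Gfin \<A> \<B>) (Gfin \<A>' \<B>')"
    using 1(2) 2(2) by (rule strategically_equivalentI)
  show "S1 \<A> \<B> \<longleftrightarrow> S1 \<A>' \<B>'"
    unfolding S1_iff_bob_can_respond
    using game_reduction_bob_can_respond[OF 1(1)] game_reduction_bob_can_respond[OF 2(1)] by blast
  show "Sfin \<A> \<B> \<longleftrightarrow> Sfin \<A>' \<B>'"
    unfolding Sfin_iff_bob_can_respond
    using game_reduction_bob_can_respond[OF 1(2)] game_reduction_bob_can_respond[OF 2(2)] by blast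
qed


section \<open>Covers and open families of convergent filters\<close>

lemma openin_bullet: "A \<subseteq> X \<Longrightarrow> openin (conv_filter_space X L) (bullet X L A)"
  unfolding openin_conv_filter_space by (rule arbitrary_union_of_inc) auto

lemma openin_conv_filter_space_bullet:
  assumes "openin (conv_filter_space X L) W" "F \<in> W"
  obtains A where "A \<subseteq> X" "F \<in> bullet X L A" "bullet X L A \<subseteq> W"
  using assms unfolding openin_conv_filter_space union_of_def by blast

lemma bullet_subset_conv_filters: "bullet X L A \<subseteq> conv_filters X L"
  by (auto simp: bullet_def)

text \<open>The intersection belongs to \<open>F\<close>, and \<open>F\<close> is proper.\<close>

lemma bullet_inter_nonempty:
  assumes "F \<in> bullet X L A" "F \<in> bullet X L B"
  shows "A \<inter> B \<noteq> {}"
proof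
  assume *: "A \<inter> B = {}"
  have "eventually (\<lambda>x. x \<in> A) F" "eventually (\<lambda>x. x \<in> B) F" "F \<noteq> bot"
    using assms by (auto simp: bullet_def filter_sets_def conv_filters_def Fil_def)
  moreover from this have "eventually (\<lambda>x. x \<in> A \<inter> B) F"
    by (simp add: eventually_conj_iff)
  ultimately show False
    using * by (simp add: trivial_limit_def)
qed

text \<open>Principal filters converge to their points. Thus every point of \<open>A\<close> is
  represented in the space of convergent filters, which links covering \<open>X\<close> with
  density.\<close>

lemma principal_in_bullet:
  assumes "convergence_space X L" "A \<subseteq> X" "x \<in> A"
  shows "principal {x} \<in> bullet X L A"
proof -
  have "x \<in> L (principal {x})" "x \<in> X"
    using assms by (auto simp: convergence_space_def)
  then show ?thesis
    using assms(2,3)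
    by (auto simp: bullet_def conv_filters_def Fil_def filter_sets_principal principal_eq_bot_iff)
qed

lemma open_covers_iff:
  "\<W> \<in> open_covers (conv_filter_space X L) \<longleftrightarrow>
     (\<forall>W\<in>\<W>. openin (conv_filter_space X L) W) \<and> conv_filters X L \<subseteq> \<Union>\<W>"
proof -
  have "W \<subseteq> conv_filters X L" if "openin (conv_filter_space X L) W" for W
    using openin_subset[OF that] by (simp add: topspace_conv_filter_space)
  then show ?thesis
    by (auto simp: open_covers_def topspace_conv_filter_space)
qed

lemma L_covers_iff:
  "\<U> \<in> L_covers X L \<longleftrightarrow> \<U> \<subseteq> Pow X \<and> conv_filters X L \<subseteq> (\<Union>U\<in>\<U>. bullet X L U)"
  by (auto simp: L_covers_def bullet_def)

text \<open>The sets \<open>bullet X L A\<close> form a base, so density need only be tested on the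
  nonempty ones.\<close>

lemma dense_open_families_iff:
  "\<W> \<in> dense_open_families (conv_filter_space X L) \<longleftrightarrow>
     (\<forall>W\<in>\<W>. openin (conv_filter_space X L) W) \<and>
     (\<forall>A\<subseteq>X. bullet X L A \<noteq> {} \<longrightarrow> (\<exists>W\<in>\<W>. W \<inter> bullet X L A \<noteq> {}))"
  (is "_ \<longleftrightarrow> ?open \<and> ?dense")
proof -
  let ?Y = "conv_filter_space X L"
  have "?Y closure_of \<Union>\<W> = topspace ?Y \<longleftrightarrow> ?dense"
  proof
    assume closure: "?Y closure_of \<Union>\<W> = topspace ?Y"
    show ?dense
    proof (intro allI impI)
      fix A assume A: "A \<subseteq> X" "bullet X L A \<noteq> {}"
      then obtain F where F: "F \<in> bullet X L A"
        by blast
      then have "F \<in> ?Y closure_of \<Union>\<W>"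
        unfolding closure topspace_conv_filter_space
        by (rule subsetD[OF bullet_subset_conv_filters])
      then show "\<exists>W\<in>\<W>. W \<inter> bullet X L A \<noteq> {}"
        using F openin_bullet[OF A(1)] unfolding in_closure_of by blast
    qed
  next
    assume dense: ?dense
    have "F \<in> ?Y closure_of \<Union>\<W>" if "F \<in> topspace ?Y" for F
      unfolding in_closure_of
    proof (intro conjI allI impI that)
      fix T assume T: "F \<in> T \<and> openin ?Y T"
      obtain A where A: "A \<subseteq> X" "F \<in> bullet X L A" "bullet X L A \<subseteq> T"
        by (rule openin_conv_filter_space_bullet[of X L T F]) (use T in auto)
      from A(2) have "bullet X L A \<noteq> {}"
        by blast
      then obtain W where "W \<in> \<W>" "W \<inter> bullet X L A \<noteq> {}"
        using dense A(1) by blast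
      with A show "\<exists>G. G \<in> \<Union>\<W> \<and> G \<in> T"
        by blast
    qed
    then show "?Y closure_of \<Union>\<W> = topspace ?Y"
      by (simp add: closure_of_subset_topspace subset_antisym subsetI)
  qed
  then show ?thesis
    by (simp add: dense_open_families_def)
qed

section \<open>Passing between L-covers and open covers\<close>

lemma bullet_cover_of_L_cover:
  assumes "\<U> \<in> L_covers X L"
  shows "bullet X L ` \<U> \<in> open_covers (conv_filter_space X L)"
  using assms by (auto simp: L_covers_iff open_covers_iff intro: openin_bullet)

text \<open>Members of an open cover need not be basic, so the cover is replaced by all basic sets
  refining it; each convergent filter has a basic neighbourhood inside some member.\<close>

lemma L_cover_of_open_cover:
  assumes "\<W> \<in> open_covers (conv_filter_space X L)"
  shows "{A. A \<subseteq> X \<and> (\<exists>W\<in>\<W>. bullet X L A \<subseteq> W)} \<in> L_covers X L"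
  unfolding L_covers_iff
proof (intro conjI subsetI)
  fix F assume "F \<in> conv_filters X L"
  then obtain W where W: "W \<in> \<W>" "openin (conv_filter_space X L) W" "F \<in> W"
    using assms by (auto simp: open_covers_iff)
  obtain A where "A \<subseteq> X" "F \<in> bullet X L A" "bullet X L A \<subseteq> W"
    using W(2,3) by (rule openin_conv_filter_space_bullet)
  with W(1) show "F \<in> (\<Union>U\<in>{A. A \<subseteq> X \<and> (\<exists>W\<in>\<W>. bullet X L A \<subseteq> W)}. bullet X L U)"
    by blast
qed blast

text \<open>Bob's selected \<open>V\<close> is enlarged to a member of the open cover it refines.
  Openness is built into the relation so that \<open>rel_set\<close> makes every member of the
  resulting family open.\<close>

lemma selection_reduction_bullet_subset:
  assumes "\<And>\<V> \<W>. \<V> \<in> \<B> \<Longrightarrow> \<forall>W\<in>\<W>. openin (conv_filter_space X L) W \<Longrightarrow>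
    \<forall>V\<in>\<V>. \<exists>W\<in>\<W>. bullet X L V \<subseteq> W \<Longrightarrow> \<W> \<in> \<B>'"
  shows "selection_reduction (\<lambda>V W. openin (conv_filter_space X L) W \<and> bullet X L V \<subseteq> W)
    (L_covers X L) \<B> (open_covers (conv_filter_space X L)) \<B>'"
  unfolding selection_reduction_def
proof (intro conjI ballI allI impI)
  fix \<W> assume \<W>: "\<W> \<in> open_covers (conv_filter_space X L)"
  show "\<exists>\<U>\<in>L_covers X L. \<forall>U\<in>\<U>. \<exists>W\<in>\<W>.
      openin (conv_filter_space X L) W \<and> bullet X L U \<subseteq> W"
    using \<W> by (intro bexI[OF _ L_cover_of_open_cover[OF \<W>]]) (auto simp: open_covers_def)
next
  fix \<V> \<W>
  assume "\<V> \<in> \<B>"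
    "rel_set (\<lambda>V W. openin (conv_filter_space X L) W \<and> bullet X L V \<subseteq> W) \<V> \<W>"
  then show "\<W> \<in> \<B>'"
    by (intro assms[of \<V>]) (auto simp: rel_set_def)
qed

text \<open>Here the cover is translated exactly, and equality in the relation makes Bob's family
  precisely the image of the family of chosen preimages under \<open>bullet X L\<close>.\<close>

lemma selection_reduction_bullet_eq:
  assumes "\<And>\<V>. \<V> \<subseteq> Pow X \<Longrightarrow> bullet X L ` \<V> \<in> \<B>' \<Longrightarrow> \<V> \<in> \<B>"
  shows "selection_reduction (\<lambda>W V. V \<subseteq> X \<and> W = bullet X L V)
    (open_covers (conv_filter_space X L)) \<B>' (L_covers X L) \<B>"
  unfolding selection_reduction_def
proof (intro conjI ballI allI impI)
  fix \<U> assume \<U>: "\<U> \<in> L_covers X L"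
  show "\<exists>\<W>\<in>open_covers (conv_filter_space X L). \<forall>W\<in>\<W>. \<exists>U\<in>\<U>. U \<subseteq> X \<and> W = bullet X L U"
    using \<U> by (intro bexI[OF _ bullet_cover_of_L_cover[OF \<U>]]) (auto simp: L_covers_def)
next
  fix \<W> \<V> assume "\<W> \<in> \<B>'" and rel: "rel_set (\<lambda>W V. V \<subseteq> X \<and> W = bullet X L V) \<W> \<V>"
  moreover from rel have "\<W> = bullet X L ` \<V>"
    by (auto simp: rel_set_def)
  ultimately show "\<V> \<in> \<B>"
    by (intro assms) (auto simp: rel_set_def)
qed

section \<open>Transfer of Bob's winning families\<close>

lemma open_covers_of_L_cover:
  assumes "\<V> \<in> L_covers X L" "\<forall>W\<in>\<W>. openin (conv_filter_space X L) W"
    "\<forall>V\<in>\<V>. \<exists>W\<in>\<W>. bullet X L V \<subseteq> W"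
  shows "\<W> \<in> open_covers (conv_filter_space X L)"
  unfolding open_covers_iff
proof
  have "conv_filters X L \<subseteq> (\<Union>V\<in>\<V>. bullet X L V)"
    using assms(1) by (simp add: L_covers_iff)
  also have "\<dots> \<subseteq> \<Union>\<W>"
    using assms(3) by (meson UN_least Union_upper order_trans)
  finally show "conv_filters X L \<subseteq> \<Union>\<W>" .
qed (rule assms(2))

lemma L_cover_of_bullet_cover:
  assumes "\<V> \<subseteq> Pow X" "bullet X L ` \<V> \<in> open_covers (conv_filter_space X L)"
  shows "\<V> \<in> L_covers X L"
  using assms by (simp add: L_covers_iff open_covers_iff)

text \<open>A nonempty basic set comes from a nonempty \<open>A\<close>. Some \<open>V\<close> in
  the cover contains a point \<open>x\<close> of \<open>A\<close>, and the principal filter at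
  \<open>x\<close> lies in both basic sets.\<close>

lemma dense_open_families_of_Cov:
  assumes "convergence_space X L" "\<V> \<in> Cov X"
    "\<forall>W\<in>\<W>. openin (conv_filter_space X L) W" "\<forall>V\<in>\<V>. \<exists>W\<in>\<W>. bullet X L V \<subseteq> W"
  shows "\<W> \<in> dense_open_families (conv_filter_space X L)"
  unfolding dense_open_families_iff
proof (intro conjI allI impI assms(3))
  fix A assume A: "A \<subseteq> X" "bullet X L A \<noteq> {}"
  \<comment> \<open>A filter in \<open>bullet X L A\<close> gives
    \<open>A \<inter> A \<noteq> {}\<close>.\<close>
  then obtain x where x: "x \<in> A"
    using bullet_inter_nonempty by blast
  then obtain V where V: "V \<in> \<V>" "V \<subseteq> X" "x \<in> V"
    using A(1) assms(2) unfolding Cov_def by blast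
  with assms(4) obtain W where W: "W \<in> \<W>" "bullet X L V \<subseteq> W"
    by blast
  have "principal {x} \<in> bullet X L A" "principal {x} \<in> bullet X L V"
    using assms(1) A(1) x V by (auto intro: principal_in_bullet)
  with W show "\<exists>W\<in>\<W>. W \<inter> bullet X L A \<noteq> {}"
    by blast
qed

lemma Cov_of_bullet_dense:
  assumes "convergence_space X L" "\<V> \<subseteq> Pow X"
    "bullet X L ` \<V> \<in> dense_open_families (conv_filter_space X L)"
  shows "\<V> \<in> Cov X"
proof -
  have "x \<in> \<Union>\<V>" if "x \<in> X" for x
  proof -
    \<comment> \<open>Density is tested on the basic set of the singleton: it contains the principal
      filter at \<open>x\<close>, and a selected set whose basic set meets it must contain
      \<open>x\<close>.\<close>
    have "{x} \<subseteq> X" "bullet X L {x} \<noteq> {}"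
      using principal_in_bullet[OF assms(1), of "{x}" x] that by blast+
    then obtain V where "V \<in> \<V>" "bullet X L V \<inter> bullet X L {x} \<noteq> {}"
      using assms(3) unfolding dense_open_families_iff by blast
    then show ?thesis
      using bullet_inter_nonempty[where A = V and B = "{x}"] by blast
  qed
  then show ?thesis
    using assms(2) by (auto simp: Cov_def)
qed

theorem theorem3p2:
  fixes X :: "'a set" and L :: "'a filter \<Rightarrow> 'a set"
  assumes "convergence_space X L"
  shows
    "(strategically_equivalent
        (G1 (L_covers X L) (L_covers X L))
        (G1 (open_covers (conv_filter_space X L)) (open_covers (conv_filter_space X L))) \<and>
      strategically_equivalent
        (Gfin (L_covers X L) (L_covers X L))
        (Gfin (open_covers (conv_filter_space X L)) (open_covers (conv_filter_space X L)))) \<and>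
     (strategically_equivalent
        (G1 (L_covers X L) (Cov X))
        (G1 (open_covers (conv_filter_space X L)) (dense_open_families (conv_filter_space X L))) \<and>
      strategically_equivalent
        (Gfin (L_covers X L) (Cov X))
        (Gfin (open_covers (conv_filter_space X L)) (dense_open_families (conv_filter_space X L)))) \<and>
     (S1 (L_covers X L) (L_covers X L) \<longleftrightarrow>
        S1 (open_covers (conv_filter_space X L)) (open_covers (conv_filter_space X L))) \<and>
     (Sfin (L_covers X L) (L_covers X L) \<longleftrightarrow>
        Sfin (open_covers (conv_filter_space X L)) (open_covers (conv_filter_space X L))) \<and>
     (S1 (L_covers X L) (Cov X) \<longleftrightarrow>
        S1 (open_covers (conv_filter_space X L)) (dense_open_families (conv_filter_space X L))) \<and>
     (Sfin (L_covers X L) (Cov X) \<longleftrightarrow>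
        Sfin (open_covers (conv_filter_space X L)) (dense_open_families (conv_filter_space X L)))"
proof -
  let ?Y = "conv_filter_space X L"
  have c1: "selection_reduction (\<lambda>V W. openin ?Y W \<and> bullet X L V \<subseteq> W)
      (L_covers X L) (L_covers X L) (open_covers ?Y) (open_covers ?Y)"
    by (rule selection_reduction_bullet_subset) (rule open_covers_of_L_cover)
  have c2: "selection_reduction (\<lambda>W V. V \<subseteq> X \<and> W = bullet X L V)
      (open_covers ?Y) (open_covers ?Y) (L_covers X L) (L_covers X L)"
    by (rule selection_reduction_bullet_eq) (rule L_cover_of_bullet_cover)
  note covers = selection_reductions_equivalent[OF c1 c2]
  \<comment> \<open>Alice's moves and both relations are as for covers; only the winning families
    change. Convergence of principal filters enters here, relating points of \<open>X\<close> to
    filters.\<close>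
  have d1: "selection_reduction (\<lambda>V W. openin ?Y W \<and> bullet X L V \<subseteq> W)
      (L_covers X L) (Cov X) (open_covers ?Y) (dense_open_families ?Y)"
    by (rule selection_reduction_bullet_subset) (rule dense_open_families_of_Cov[OF assms])
  have d2: "selection_reduction (\<lambda>W V. V \<subseteq> X \<and> W = bullet X L V)
      (open_covers ?Y) (dense_open_families ?Y) (L_covers X L) (Cov X)"
    by (rule selection_reduction_bullet_eq) (rule Cov_of_bullet_dense[OF assms])
  note dense = selection_reductions_equivalent[OF d1 d2]
  show ?thesis
    by (intro conjI covers dense)
qed

end
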